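(* Let $P$ be the diagonalizable transition matrix of an absorbing Markov chain restricted to its finite set $\mathcal{T}$ of transient states, with boundary fluxes $b^{(0)},b^{(1)}$, $b=b^{(0)}+b^{(1)}$, and spectral coefficients $A_\nu,B_\nu$ as in the context. Let $\sigma:\mathcal{T}\to\mathcal{T}$ be an involution and $\kappa:\mathcal{T}\to(0,\infty)$ a weight (independent of $\nu$) such that $B_\nu(z)=\kappa(z)A_\nu(\sigma(z))$ for all $\nu$ and all $z\in\mathcal{T}$, and $\kappa(z)\kappa(\sigma(z))=K$ is independent of $z$. Assume also the twisted boundary pairing $b^{(1)}=\Delta^2\mathcal{R}\,b^{(0)}$, i.e. $b^{(1)}_z=\kappa(z)b^{(0)}_{\sigma(z)}$ for all $z\in\mathcal{T}$. Then for every $\gamma\in(0,1)$, $$(I+\mathcal{R})\,\Delta^{-1}R(\gamma)\,(b^{(0)}-C^*b)=0,\qquad C^*=\frac{1}{1+\sqrt K}.$$ Equivalently, the normalized deviation field $\eta(\gamma):=\Delta^{-1}[u(\gamma)-C^*s(\gamma)]$ is $\sigma$-antisymmetric: $\eta_{\sigma(z)}(\gamma)=-\eta_z(\gamma)$ for all $z\in\mathcal{T}$.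
   Context: Setting. A Markov chain lives on a finite set $\mathcal{T}\cup\partial_0\cup\partial_1$ (disjoint union); $\mathcal{T}$ consists of transient states, $\partial_0\cup\partial_1$ is the absorbing boundary, the restriction of the chain to $\mathcal{T}$ is irreducible, and absorption is certain from every state of $\mathcal{T}$. $P=(P_{z,w})_{z,w\in\mathcal{T}}$ is the restricted transition matrix (spectral radius $<1$), and $R(\gamma)=(I-(1-\gamma)P)^{-1}$ for $\gamma\in(0,1)$. The boundary fluxes are $b^{(0)}_x=\sum_{y\in\partial_0}P_{xy}$, $b^{(1)}_x=\sum_{y\in\partial_1}P_{xy}$. The first-passage vectors are $u(\gamma)=R(\gamma)b^{(0)}$ and $s(\gamma)=R(\gamma)b$. $P$ is diagonalizable with eigenvalues $\lambda_\nu$ and biorthogonal right/left eigenvectors $\varphi_\nu,\psi_\nu$ ($\nu=1,\dots,|\mathcal{T}|$): $P\varphi_\nu=\lambda_\nu\varphi_\nu$, $\psi_\nu^{\mathsf T}P=\lambda_\nu\psi_\nu^{\mathsf T}$, $\psi_\nu^{\mathsf T}\varphi_\mu=\delta_{\nu\mu}$. The spectral coefficients are $A_\nu(z)=\varphi_\nu(z)(\psi_\nu^{\mathsf T}b^{(0)})$, $B_\nu(z)=\varphi_\nu(z)(\psi_\nu^{\mathsf T}b^{(1)})$. Operators on functions $f:\mathcal{T}\to\mathbb{C}$: $(\mathcal{R}f)(z)=f(\sigma(z))$ and $\Delta=\operatorname{diag}(\sqrt{\kappa(z)})$. *)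

theory Defs
  imports "HOL-Probability.Probability"
begin

text \<open>
  The state space is the finite type \<open>'t + 'd\<close>: transient states are \<open>Inl z\<close>, absorbing ones
  \<open>Inr y\<close>. The two boundary parts are sets of type \<open>'d set\<close> that partition \<open>'d\<close>, so either one
  may be empty. (That \<open>'t\<close> and \<open>'d\<close> are nonempty is no restriction: without boundary states,
  absorption from a transient state is impossible.) A chain is given by its transition kernel.
\<close>

primrec n_step :: "('s \<Rightarrow> 's pmf) \<Rightarrow> nat \<Rightarrow> 's \<Rightarrow> 's pmf" where
  "n_step k 0 x = return_pmf x"
| "n_step k (Suc n) x = bind_pmf (k x) (n_step k n)"

definition irreducible_on_transient :: "('t + 'd \<Rightarrow> ('t + 'd) pmf) \<Rightarrow> bool" where
  "irreducible_on_transient k \<longleftrightarrow>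
     (\<forall>x y. (x, y) \<in> {(v, w). pmf (k (Inl v)) (Inl w) > 0}\<^sup>*)"

text \<open>
  Boundary states are never left, so the event of being in the boundary at time \<open>n\<close> increases
  with \<open>n\<close>, and the limit below is the probability of ever being absorbed.
\<close>

definition certain_absorption :: "('t + 'd \<Rightarrow> ('t + 'd) pmf) \<Rightarrow> bool" where
  "certain_absorption k \<longleftrightarrow>
     (\<forall>z. (\<lambda>n. measure_pmf.prob (n_step k n (Inl z)) (range Inr)) \<longlonglongrightarrow> 1)"

definition absorbing_chain ::
  "('t::finite + 'd::finite \<Rightarrow> ('t + 'd) pmf) \<Rightarrow> 'd set \<Rightarrow> 'd set \<Rightarrow> bool" where
  "absorbing_chain k D0 D1 \<longleftrightarrow>
     D0 \<inter> D1 = {} \<and> D0 \<union> D1 = UNIV \<and>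
     (\<forall>y. k (Inr y) = return_pmf (Inr y)) \<and>
     irreducible_on_transient k \<and> certain_absorption k"

definition transient_matrix ::
  "('t::finite + 'd \<Rightarrow> ('t + 'd) pmf) \<Rightarrow> complex^'t^'t" where
  "transient_matrix k = (\<chi> z w. complex_of_real (pmf (k (Inl z)) (Inl w)))"

definition boundary_flux ::
  "('t::finite + 'd::finite \<Rightarrow> ('t + 'd) pmf) \<Rightarrow> 'd set \<Rightarrow> complex^'t" where
  "boundary_flux k D = (\<chi> x. complex_of_real (\<Sum>y\<in>D. pmf (k (Inl x)) (Inr y)))"

definition resolvent :: "complex^'t^'t \<Rightarrow> real \<Rightarrow> complex^'t^('t::finite)" where
  "resolvent P \<gamma> = matrix_inv (mat 1 - (\<chi> z w. complex_of_real (1 - \<gamma>) * P $ z $ w))"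

text \<open>The bilinear pairing \<open>v\<^sup>T w\<close>, without complex conjugation.\<close>

definition pairing :: "complex^'t \<Rightarrow> complex^('t::finite) \<Rightarrow> complex" where
  "pairing v w = (\<Sum>z\<in>UNIV. v $ z * w $ z)"

text \<open>
  The existence of such a family, with as many members as the dimension, is diagonalizability
  of \<open>P\<close> over the complex numbers.
\<close>

definition biorthogonal_eigensystem ::
  "complex^'t^'t \<Rightarrow> (nat \<Rightarrow> complex) \<Rightarrow> (nat \<Rightarrow> complex^'t) \<Rightarrow> (nat \<Rightarrow> complex^('t::finite)) \<Rightarrow> bool"
where
  "biorthogonal_eigensystem P eigval \<phi> \<psi> \<longleftrightarrow>
     (\<forall>\<nu>\<in>{1..CARD('t)}. P *v \<phi> \<nu> = eigval \<nu> *s \<phi> \<nu> \<and> \<psi> \<nu> v* P = eigval \<nu> *s \<psi> \<nu>) \<and>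
     (\<forall>\<nu>\<in>{1..CARD('t)}. \<forall>\<mu>\<in>{1..CARD('t)}.
        pairing (\<psi> \<nu>) (\<phi> \<mu>) = (if \<nu> = \<mu> then 1 else 0))"

text \<open>This is \<open>A\<^sub>\<nu>(z)\<close> for the flux \<open>b\<^sup>(\<^sup>0\<^sup>)\<close> and \<open>B\<^sub>\<nu>(z)\<close> for the flux \<open>b\<^sup>(\<^sup>1\<^sup>)\<close>.\<close>

definition spectral_coeff ::
  "(nat \<Rightarrow> complex^'t) \<Rightarrow> (nat \<Rightarrow> complex^('t::finite)) \<Rightarrow> complex^'t \<Rightarrow> nat \<Rightarrow> 't \<Rightarrow> complex" where
  "spectral_coeff \<phi> \<psi> b \<nu> z = \<phi> \<nu> $ z * pairing (\<psi> \<nu>) b"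

definition reflect :: "('t \<Rightarrow> 't) \<Rightarrow> complex^'t \<Rightarrow> complex^('t::finite)" where
  "reflect \<sigma> f = (\<chi> z. f $ \<sigma> z)"

definition Delta :: "('t \<Rightarrow> real) \<Rightarrow> complex^'t^('t::finite)" where
  "Delta \<kappa> = (\<chi> z w. if z = w then complex_of_real (sqrt (\<kappa> z)) else 0)"

definition Cstar :: "real \<Rightarrow> complex" where
  "Cstar K = complex_of_real (1 / (1 + sqrt K))"

definition deviation_field ::
  "complex^'t^'t \<Rightarrow> complex^'t \<Rightarrow> complex^'t \<Rightarrow> ('t \<Rightarrow> real) \<Rightarrow> real \<Rightarrow> real \<Rightarrow> complex^('t::finite)"
where
  "deviation_field P b0 b \<kappa> K \<gamma> =
     (let u = resolvent P \<gamma> *v b0; s = resolvent P \<gamma> *v b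
      in matrix_inv (Delta \<kappa>) *v (u - Cstar K *s s))"

end

theory Submission imports Defs begin

text \<open>
  Why the field is antisymmetric. Expanding a boundary flux in the right eigenvectors of \<open>P\<close> and
  applying the resolvent gives
  \<open>(R(\<gamma>) b\<^sup>(\<^sup>0\<^sup>))(z) = (\<Sum>\<nu>. A\<^sub>\<nu>(z) / (1 - (1 - \<gamma>) \<lambda>\<^sub>\<nu>))\<close>, and likewise
  for \<open>b\<^sup>(\<^sup>1\<^sup>)\<close> with \<open>B\<^sub>\<nu>\<close> (\<open>resolvent_spectral_expansion\<close>). The factors
  \<open>1 / (1 - (1 - \<gamma>) \<lambda>\<^sub>\<nu>)\<close> are common to both sums and do not depend on \<open>z\<close>, so the mode-wise
  relation \<open>B\<^sub>\<nu>(z) = \<kappa>(z) A\<^sub>\<nu>(\<sigma>(z))\<close> passes to the sums: \<open>v(z) = \<kappa>(z) u(\<sigma>(z))\<close> for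
  \<open>u = R(\<gamma>) b\<^sup>(\<^sup>0\<^sup>)\<close> and \<open>v = R(\<gamma>) b\<^sup>(\<^sup>1\<^sup>)\<close>.

  With \<open>C = 1 / (1 + \<surd>K)\<close> this yields
  \<open>u(z) - C (u(z) + v(z)) = (\<surd>K u(z) - \<kappa>(z) u(\<sigma>(z))) / (1 + \<surd>K)\<close>. Since
  \<open>\<surd>K = \<surd>\<kappa>(z) \<surd>\<kappa>(\<sigma>(z))\<close>, division by \<open>\<surd>\<kappa>(z)\<close> leaves
  \<open>(\<surd>\<kappa>(\<sigma>(z)) u(z) - \<surd>\<kappa>(z) u(\<sigma>(z))) / (1 + \<surd>K)\<close>, which visibly changes sign when
  \<open>z\<close> and \<open>\<sigma>(z)\<close> are exchanged (\<open>twisted_deviation_antisymmetric\<close>).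

  The expansion needs \<open>I - (1 - \<gamma>) P\<close> to be invertible. The factor \<open>1 - \<gamma> < 1\<close> makes
  \<open>(1 - \<gamma>) P\<close> a strict contraction in the maximum norm because the rows of \<open>P\<close> sum to at most
  one (\<open>invertible_one_minus_contraction\<close>).
\<close>

lemma matrix_inv_mult:
  assumes "invertible A"
  shows "A ** matrix_inv A = mat 1" "matrix_inv A ** A = mat 1"
  using someI_ex[OF assms[unfolded invertible_def]] by (simp_all add: matrix_inv_def)

text \<open>
  A kernel vector \<open>x\<close> satisfies \<open>x = c P x\<close>. At a coordinate of maximal modulus \<open>m\<close> this gives
  \<open>m \<le> \<bar>c\<bar> m\<close>, hence \<open>m = 0\<close>.
\<close>

lemma invertible_one_minus_contraction:
  fixes P :: "complex^'n^'n"
  assumes row: "\<And>z. (\<Sum>w\<in>UNIV. norm (P $ z $ w)) \<le> 1"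
    and c: "norm c < 1"
  shows "invertible (mat 1 - (\<chi> z w. c * P $ z $ w))"
proof -
  let ?M = "mat 1 - (\<chi> z w. c * P $ z $ w) :: complex^'n^'n"
  have "x = 0" if "?M *v x = 0" for x
  proof -
    have fixp: "x $ z = c * (\<Sum>w\<in>UNIV. P $ z $ w * x $ w)" for z
    proof -
      have "x = (\<chi> z w. c * P $ z $ w) *v x"
        using that by (simp add: matrix_vector_mult_diff_rdistrib)
      then have "x $ z = ((\<chi> z w. c * P $ z $ w) *v x) $ z"
        by simp
      then show ?thesis
        by (simp add: matrix_vector_mult_def sum_distrib_left mult.assoc)
    qed
    define m where "m = Max (range (\<lambda>w. norm (x $ w)))"
    have le_m: "norm (x $ w) \<le> m" for w
      unfolding m_def by (intro Max_ge) auto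
    have "m \<in> range (\<lambda>w. norm (x $ w))"
      unfolding m_def by (intro Max_in) auto
    then obtain z where z: "m = norm (x $ z)"
      by auto
    have m0: "0 \<le> m"
      by (simp add: z)
    have "norm (\<Sum>w\<in>UNIV. P $ z $ w * x $ w) \<le> (\<Sum>w\<in>UNIV. norm (P $ z $ w) * m)"
      by (intro sum_norm_le) (auto simp: norm_mult intro: mult_left_mono le_m)
    also have "\<dots> = (\<Sum>w\<in>UNIV. norm (P $ z $ w)) * m"
      by (simp add: sum_distrib_right)
    also have "\<dots> \<le> m"
      using mult_right_mono[OF row[of z] m0] by simp
    finally have "m \<le> norm c * m"
      using z fixp[of z] by (metis mult_left_mono norm_ge_zero norm_mult)
    then have "(1 - norm c) * m \<le> 0"
      by (simp add: algebra_simps)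
    then have "m = 0"
      using c m0 by (simp add: mult_le_0_iff)
    then show "x = 0"
      using le_m by (simp add: vec_eq_iff)
  qed
  then show ?thesis
    by (simp add: invertible_left_inverse matrix_left_invertible_ker)
qed

lemma transient_matrix_row_sum_le_one:
  "(\<Sum>w\<in>UNIV. norm (transient_matrix k $ z $ w)) \<le> 1"
proof -
  have "(\<Sum>w\<in>UNIV. norm (transient_matrix k $ z $ w)) = (\<Sum>s\<in>range Inl. pmf (k (Inl z)) s)"
    by (simp add: transient_matrix_def sum.reindex)
  also have "\<dots> = measure_pmf.prob (k (Inl z)) (range Inl)"
    by (simp add: measure_measure_pmf_finite)
  finally show ?thesis
    by simp
qed

text \<open>
  Biorthogonality says that the matrix with rows \<open>\<psi>\<^sub>\<nu>\<close> is a left inverse of the square matrix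
  with columns \<open>\<phi>\<^sub>\<nu>\<close>. It is then also a right inverse, and that is the completeness relation
  \<open>(\<Sum>\<nu>. \<phi>\<^sub>\<nu> \<psi>\<^sub>\<nu>\<^sup>T) = I\<close>.
\<close>

lemma biorthogonal_expansion:
  fixes \<phi> \<psi> :: "nat \<Rightarrow> complex^'n"
  assumes biorth: "\<And>\<nu> \<mu>. \<nu> \<in> {1..CARD('n)} \<Longrightarrow> \<mu> \<in> {1..CARD('n)} \<Longrightarrow>
      pairing (\<psi> \<nu>) (\<phi> \<mu>) = (if \<nu> = \<mu> then 1 else 0)"
  shows "x = (\<Sum>\<nu>\<in>{1..CARD('n)}. pairing (\<psi> \<nu>) x *s \<phi> \<nu>)"
proof -
  \<comment> \<open>Number the coordinates, so that both families become matrices of the same square type.\<close>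
  obtain g where g: "bij_betw g (UNIV :: 'n set) {1..CARD('n)}"
    using finite_same_card_bij[of "UNIV :: 'n set" "{1..CARD('n)}"] by auto
  have g_mem: "g i \<in> {1..CARD('n)}" for i
    using g by (auto simp: bij_betw_def)
  have g_inj: "g i = g j \<longleftrightarrow> i = j" for i j
    using g by (auto simp: bij_betw_def inj_eq)
  define V where "V = (\<chi> z i. \<phi> (g i) $ z)"
  define W where "W = (\<chi> i z. \<psi> (g i) $ z)"
  have "W ** V = mat 1"
    using biorth[OF g_mem g_mem]
    by (simp add: V_def W_def matrix_matrix_mult_def mat_def vec_eq_iff pairing_def g_inj)
  then have "V ** W = mat 1"
    by (simp add: matrix_left_right_inverse)
  then have "x = V *v (W *v x)"
    by (simp add: matrix_vector_mul_assoc)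
  also have "\<dots> = (\<Sum>i\<in>UNIV. pairing (\<psi> (g i)) x *s \<phi> (g i))"
    by (simp add: V_def W_def matrix_vector_mult_def vec_eq_iff pairing_def mult.commute)
  also have "\<dots> = (\<Sum>\<nu>\<in>{1..CARD('n)}. pairing (\<psi> \<nu>) x *s \<phi> \<nu>)"
    by (rule sum.reindex_bij_betw[OF g])
  finally show ?thesis .
qed

text \<open>
  The resolvent acts on \<open>\<phi>\<^sub>\<nu>\<close> as division by \<open>1 - (1 - \<gamma>) \<lambda>\<^sub>\<nu>\<close>. This number is nonzero
  because the invertible matrix \<open>I - (1 - \<gamma>) P\<close> maps \<open>\<phi>\<^sub>\<nu> \<noteq> 0\<close> to that multiple of itself.
\<close>

lemma resolvent_spectral_expansion:
  fixes P :: "complex^'n^'n"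
  assumes eigen: "biorthogonal_eigensystem P eigval \<phi> \<psi>"
    and inv: "invertible (mat 1 - (\<chi> z w. complex_of_real (1 - \<gamma>) * P $ z $ w))"
  shows "(resolvent P \<gamma> *v x) $ z =
    (\<Sum>\<nu>\<in>{1..CARD('n)}. spectral_coeff \<phi> \<psi> x \<nu> z / (1 - complex_of_real (1 - \<gamma>) * eigval \<nu>))"
proof -
  let ?c = "complex_of_real (1 - \<gamma>)"
  define M where "M = mat 1 - (\<chi> z w. ?c * P $ z $ w)"
  define d where "d \<nu> = 1 - ?c * eigval \<nu>" for \<nu>
  have biorth: "pairing (\<psi> \<nu>) (\<phi> \<mu>) = (if \<nu> = \<mu> then 1 else 0)"
    if "\<nu> \<in> {1..CARD('n)}" "\<mu> \<in> {1..CARD('n)}" for \<nu> \<mu>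
    using eigen that by (simp add: biorthogonal_eigensystem_def)
  have inv_M: "matrix_inv M ** M = mat 1"
    using inv by (simp add: M_def matrix_inv_mult)
  have M_apply: "M *v y = y - ?c *s (P *v y)" for y
    by (simp add: M_def matrix_vector_mult_diff_rdistrib del: of_real_diff)
       (simp add: matrix_vector_mult_def vec_eq_iff sum_distrib_left mult.assoc
        del: of_real_diff)
  have M_eig: "M *v \<phi> \<nu> = d \<nu> *s \<phi> \<nu>" if "\<nu> \<in> {1..CARD('n)}" for \<nu>
  proof -
    have "P *v \<phi> \<nu> = eigval \<nu> *s \<phi> \<nu>"
      using eigen that by (simp add: biorthogonal_eigensystem_def)
    then show ?thesis
      by (simp add: M_apply d_def vec_eq_iff algebra_simps)
  qed
  have R_eig: "matrix_inv M *v \<phi> \<nu> = (1 / d \<nu>) *s \<phi> \<nu>" if \<nu>: "\<nu> \<in> {1..CARD('n)}" for \<nu>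
  proof -
    have "matrix_inv M *v (M *v \<phi> \<nu>) = \<phi> \<nu>"
      by (simp add: matrix_vector_mul_assoc inv_M)
    then have *: "d \<nu> *s (matrix_inv M *v \<phi> \<nu>) = \<phi> \<nu>"
      using M_eig[OF \<nu>] by (simp add: vector_scalar_commute)
    have "\<phi> \<nu> \<noteq> 0"
      using biorth[OF \<nu> \<nu>] by (auto simp: pairing_def)
    then have "d \<nu> \<noteq> 0"
      using * by auto
    then show ?thesis
      by (subst (2) *[symmetric]) simp
  qed
  have "matrix_inv M *v x = matrix_inv M *v (\<Sum>\<nu>\<in>{1..CARD('n)}. pairing (\<psi> \<nu>) x *s \<phi> \<nu>)"
    using biorthogonal_expansion[OF biorth, of x] by simp
  also have "\<dots> = (\<Sum>\<nu>\<in>{1..CARD('n)}. pairing (\<psi> \<nu>) x *s (matrix_inv M *v \<phi> \<nu>))"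
    by (simp add: vec.linear_sum[OF matrix_vector_mul_linear_gen] vector_scalar_commute)
  also have "\<dots> = (\<Sum>\<nu>\<in>{1..CARD('n)}. pairing (\<psi> \<nu>) x *s ((1 / d \<nu>) *s \<phi> \<nu>))"
    using R_eig by (intro sum.cong) auto
  finally show ?thesis
    unfolding resolvent_def M_def[symmetric] d_def[symmetric]
    by (simp add: spectral_coeff_def mult.commute)
qed

lemma matrix_inv_Delta_apply:
  assumes "\<And>z. \<kappa> z > 0"
  shows "(matrix_inv (Delta \<kappa>) *v x) $ z = x $ z / complex_of_real (sqrt (\<kappa> z))"
proof -
  have Delta_apply: "(Delta \<kappa> *v y) $ w = complex_of_real (sqrt (\<kappa> w)) * y $ w" for y w
    by (simp add: Delta_def matrix_vector_mult_def if_distrib[of "\<lambda>a. a * _"] cong: if_cong)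
  have nz: "complex_of_real (sqrt (\<kappa> w)) \<noteq> 0" for w
    using assms[of w] by simp
  have "y = 0" if "Delta \<kappa> *v y = 0" for y
  proof -
    have "complex_of_real (sqrt (\<kappa> w)) * y $ w = 0" for w
      using that by (simp flip: Delta_apply)
    then show ?thesis
      using nz by (simp add: vec_eq_iff)
  qed
  then have "invertible (Delta \<kappa>)"
    by (simp add: invertible_left_inverse matrix_left_invertible_ker)
  then have "Delta \<kappa> *v (matrix_inv (Delta \<kappa>) *v x) = x"
    by (simp add: matrix_vector_mul_assoc matrix_inv_mult)
  then have "complex_of_real (sqrt (\<kappa> z)) * (matrix_inv (Delta \<kappa>) *v x) $ z = x $ z"
    by (metis Delta_apply)
  then show ?thesis
    using nz[of z] by (simp add: field_simps)
qed

text \<open>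
  The choice \<open>C = 1 / (1 + \<surd>K)\<close> is the one that balances the two terms: \<open>1 - C = C \<surd>K\<close>, and
  \<open>\<surd>K\<close> splits as \<open>\<surd>\<kappa>(z) \<surd>\<kappa>(z')\<close>.
\<close>

lemma twisted_deviation_antisymmetric:
  fixes p q :: complex and a a' K :: real
  assumes a: "a > 0" and a': "a' > 0" and K: "a * a' = K"
  shows "(q - Cstar K * (q + a' * p)) / complex_of_real (sqrt a') =
       - ((p - Cstar K * (p + a * q)) / complex_of_real (sqrt a))"
proof -
  have normal: "(p - Cstar K * (p + a * q)) / complex_of_real (sqrt a) =
      Cstar K * (sqrt a' * p - sqrt a * q)"
    if "a > 0" "a' > 0" "a * a' = K" for a a' :: real and p q :: complex
  proof -
    have "1 + sqrt K > 0"
      using that by (auto intro!: add_pos_nonneg)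
    then have "(1 - 1 / (1 + sqrt K)) = (1 / (1 + sqrt K)) * (sqrt a * sqrt a')"
      using that by (auto simp: field_simps simp flip: real_sqrt_mult)
    then have C: "1 - Cstar K = Cstar K * (sqrt a * sqrt a')"
      unfolding Cstar_def by (metis of_real_1 of_real_diff of_real_mult)
    have sq: "complex_of_real a = sqrt a * sqrt a"
      using that by (simp flip: of_real_mult)
    have "p - Cstar K * (p + a * q) = (1 - Cstar K) * p - Cstar K * a * q"
      by (simp add: algebra_simps)
    also have "\<dots> = Cstar K * (sqrt a' * p - sqrt a * q) * sqrt a"
      by (simp only: C) (simp only: sq of_real_mult algebra_simps)
    finally show ?thesis
      using that by simp
  qed
  have K': "a' * a = K"
    using K by (simp add: mult.commute)
  show ?thesis
    by (simp only: normal[OF a a' K] normal[OF a' a K']) (simp add: algebra_simps)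
qed

theorem mainTheorem4:
  fixes k :: "'t::finite + 'd::finite \<Rightarrow> ('t + 'd) pmf"
    and D0 D1 :: "'d set"
    and P :: "complex^'t^'t"
    and b0 b1 b :: "complex^'t"
    and eigval :: "nat \<Rightarrow> complex"
    and \<phi> \<psi> :: "nat \<Rightarrow> complex^'t"
    and \<sigma> :: "'t \<Rightarrow> 't"
    and \<kappa> :: "'t \<Rightarrow> real"
    and K \<gamma> :: real
  assumes chain: "absorbing_chain k D0 D1"
    and P_def: "P = transient_matrix k"
    and b0_def: "b0 = boundary_flux k D0"
    and b1_def: "b1 = boundary_flux k D1"
    and b_def: "b = b0 + b1"
    and eigen: "biorthogonal_eigensystem P eigval \<phi> \<psi>"
    and involution: "\<And>z. \<sigma> (\<sigma> z) = z"
    and kappa_pos: "\<And>z. \<kappa> z > 0"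
    and coeff: "\<And>\<nu> z. \<nu> \<in> {1..CARD('t)} \<Longrightarrow>
      spectral_coeff \<phi> \<psi> b1 \<nu> z = complex_of_real (\<kappa> z) * spectral_coeff \<phi> \<psi> b0 \<nu> (\<sigma> z)"
    and kappa_K: "\<And>z. \<kappa> z * \<kappa> (\<sigma> z) = K"
    and twisted_pairing: "b1 = (Delta \<kappa> ** Delta \<kappa>) *v reflect \<sigma> b0"
    and gamma: "0 < \<gamma>" "\<gamma> < 1"
  shows "(\<lambda>f. f + reflect \<sigma> f)
           (matrix_inv (Delta \<kappa>) *v (resolvent P \<gamma> *v (b0 - Cstar K *s b))) = 0
       \<and> (\<forall>z. deviation_field P b0 b \<kappa> K \<gamma> $ \<sigma> z = - (deviation_field P b0 b \<kappa> K \<gamma> $ z))"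
proof -
  define u where "u = resolvent P \<gamma> *v b0"
  define v where "v = resolvent P \<gamma> *v b1"
  define \<eta> where "\<eta> = deviation_field P b0 b \<kappa> K \<gamma>"
  have inv: "invertible (mat 1 - (\<chi> z w. complex_of_real (1 - \<gamma>) * P $ z $ w))"
    using gamma unfolding P_def
    by (intro invertible_one_minus_contraction transient_matrix_row_sum_le_one)
       (simp del: of_real_diff)
  have v_u: "v $ z = complex_of_real (\<kappa> z) * u $ \<sigma> z" for z
    unfolding u_def v_def resolvent_spectral_expansion[OF eigen inv]
    by (simp add: coeff sum_distrib_left)
  have Rb: "resolvent P \<gamma> *v b = u + v"
    by (simp add: b_def u_def v_def matrix_vector_right_distrib)
  have \<eta>: "\<eta> $ z = (u $ z - Cstar K * (u $ z + complex_of_real (\<kappa> z) * u $ \<sigma> z)) /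
      complex_of_real (sqrt (\<kappa> z))" for z
    unfolding \<eta>_def deviation_field_def Let_def Rb u_def[symmetric]
    by (simp only: matrix_inv_Delta_apply[OF kappa_pos] v_u vector_minus_component
        vector_add_component vector_smult_component)
  have anti: "\<eta> $ \<sigma> z = - (\<eta> $ z)" for z
    using twisted_deviation_antisymmetric[OF kappa_pos kappa_pos kappa_K, of "u $ \<sigma> z" z "u $ z"]
    by (simp add: \<eta> involution)
  have "resolvent P \<gamma> *v (b0 - Cstar K *s b) = u - Cstar K *s (resolvent P \<gamma> *v b)"
    by (simp add: u_def matrix_vector_mult_diff_distrib vector_scalar_commute)
  then have "matrix_inv (Delta \<kappa>) *v (resolvent P \<gamma> *v (b0 - Cstar K *s b)) = \<eta>"
    by (simp add: \<eta>_def deviation_field_def Let_def u_def)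
  then show ?thesis
    using anti by (simp add: \<eta>_def[symmetric] reflect_def vec_eq_iff)
qed

end
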